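(* Let $\alpha>0$ and $\lambda>0$, let $n$ be the smallest integer greater than or equal to $\alpha$, and let $m\ge n$ be an integer. Then for all $t>0$, $$\mathcal{D}^{\alpha}\mathcal{B}_m(t:\alpha\mid\lambda)=\frac{\Gamma(m+1)}{\Gamma(m-n+1)}\sum_{k=0}^{m-n}\frac{k!\binom{m-n}{k}\mathcal{B}_{m-n-k}(\alpha\mid\lambda)}{\Gamma(n+k-\alpha+1)}\,t^{k-\alpha+n},$$ $$\mathcal{D}^{\alpha}\mathcal{E}_m(t:\alpha\mid\lambda)=\frac{\Gamma(m+1)}{\Gamma(m-n+1)}\sum_{k=0}^{m-n}\frac{k!\binom{m-n}{k}\mathcal{E}_{m-n-k}(\alpha\mid\lambda)}{\Gamma(n+k-\alpha+1)}\,t^{k-\alpha+n},$$ and $$\mathcal{D}^{\alpha}\mathcal{G}_m(t:\alpha\mid\lambda)=\frac{\Gamma(m+1)}{\Gamma(m-n+1)}\sum_{k=0}^{m-n}\frac{k!\binom{m-n}{k}\mathcal{G}_{m-n-k}(\alpha\mid\lambda)}{\Gamma(n+k-\alpha+1)}\,t^{k-\alpha+n}.$$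
   Context: The Mittag-Leffler function is $E_\alpha(z)=\sum_{j=0}^{\infty}\frac{z^j}{\Gamma(\alpha j+1)}$. For $\alpha>0$ and $\lambda>0$, the Bernoulli-type polynomials $\mathcal{B}_m(x:\alpha\mid\lambda)$, Euler-type polynomials $\mathcal{E}_m(x:\alpha\mid\lambda)$ and Genocchi-type polynomials $\mathcal{G}_m(x:\alpha\mid\lambda)$ ($m\ge 0$) are defined by the generating functions (power series in $z$ at $0$) $$\sum_{m=0}^{\infty}\mathcal{B}_m(x:\alpha\mid\lambda)\frac{z^m}{m!}=\frac{z}{\lambda E_\alpha(z)-1}e^{xz},\quad \sum_{m=0}^{\infty}\mathcal{E}_m(x:\alpha\mid\lambda)\frac{z^m}{m!}=\frac{2}{\lambda E_\alpha(z)+1}e^{xz},\quad \sum_{m=0}^{\infty}\mathcal{G}_m(x:\alpha\mid\lambda)\frac{z^m}{m!}=\frac{2z}{\lambda E_\alpha(z)+1}e^{xz}.$$ The corresponding numbers are the values at $x=0$: $\mathcal{B}_m(\alpha\mid\lambda):=\mathcal{B}_m(0:\alpha\mid\lambda)$, $\mathcal{E}_m(\alpha\mid\lambda):=\mathcal{E}_m(0:\alpha\mid\lambda)$, $\mathcal{G}_m(\alpha\mid\lambda):=\mathcal{G}_m(0:\alpha\mid\lambda)$. For $\alpha>0$ and $n$ the smallest integer $\ge\alpha$, the Caputo fractional derivative of order $\alpha$ of a function $f:(0,\infty)\to\mathbb{R}$ is $$\mathcal{D}^{\alpha}f(t)=\frac{1}{\Gamma(n-\alpha)}\int_{0}^{t}\frac{f^{(n)}(s)}{(t-s)^{\alpha-n+1}}\,ds,$$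 with the usual convention $\mathcal{D}^{\alpha}f=f^{(n)}$ when $\alpha=n$ is an integer. In the claim, $\mathcal{D}^{\alpha}$ acts in the variable $t$, and the same $\alpha$ is both the order of differentiation and the Mittag-Leffler parameter. *)

theory Defs
  imports "HOL-Analysis.Analysis"
begin

definition mittag_leffler :: "real \<Rightarrow> real \<Rightarrow> real" where
  "mittag_leffler \<alpha> z = (\<Sum>j. z ^ j / Gamma (\<alpha> * real j + 1))"

definition mittag_leffler_fps :: "real \<Rightarrow> real fps" where
  "mittag_leffler_fps \<alpha> = Abs_fps (\<lambda>j. 1 / Gamma (\<alpha> * real j + 1))"

text \<open>
  The generating functions are read as formal power series in \<open>z\<close>; \<^term>\<open>fps_exp x\<close> is the series
  of \<open>exp (x * z)\<close>. For \<open>lam = 1\<close> the denominator in the Bernoulli case has a simple zero at \<open>0\<close>, which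
  division of formal power series cancels against the factor \<^term>\<open>fps_X\<close> (it would be \<open>0 / 0\<close> at
  \<open>z = 0\<close> if the quotient were read pointwise). The lemmas below confirm that the divisions are exact
  for all admissible parameters and that \<open>mittag_leffler_fps\<close> is the power series of
  \<open>mittag_leffler\<close>.
\<close>

definition bernoulli_ml :: "real \<Rightarrow> real \<Rightarrow> nat \<Rightarrow> real \<Rightarrow> real" where
  "bernoulli_ml \<alpha> lam m x = fact m *
     fps_nth (fps_X / (fps_const lam * mittag_leffler_fps \<alpha> - 1) * fps_exp x) m"

definition euler_ml :: "real \<Rightarrow> real \<Rightarrow> nat \<Rightarrow> real \<Rightarrow> real" where
  "euler_ml \<alpha> lam m x = fact m *
     fps_nth (2 / (fps_const lam * mittag_leffler_fps \<alpha> + 1) * fps_exp x) m"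

definition genocchi_ml :: "real \<Rightarrow> real \<Rightarrow> nat \<Rightarrow> real \<Rightarrow> real" where
  "genocchi_ml \<alpha> lam m x = fact m *
     fps_nth (2 * fps_X / (fps_const lam * mittag_leffler_fps \<alpha> + 1) * fps_exp x) m"

definition bernoulli_ml_num :: "real \<Rightarrow> real \<Rightarrow> nat \<Rightarrow> real" where
  "bernoulli_ml_num \<alpha> lam m = bernoulli_ml \<alpha> lam m 0"

definition euler_ml_num :: "real \<Rightarrow> real \<Rightarrow> nat \<Rightarrow> real" where
  "euler_ml_num \<alpha> lam m = euler_ml \<alpha> lam m 0"

definition genocchi_ml_num :: "real \<Rightarrow> real \<Rightarrow> nat \<Rightarrow> real" where
  "genocchi_ml_num \<alpha> lam m = genocchi_ml \<alpha> lam m 0"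

text \<open>
  Caputo derivative of order \<open>\<alpha> > 0\<close>. For \<open>t > 0\<close> it depends only on \<open>f\<close> restricted to \<open>(0, t]\<close> and,
  at integer order, on \<open>f\<close> near \<open>t\<close>: the values of the integrand at the two end points do not affect
  the integral.
\<close>

definition caputo :: "real \<Rightarrow> (real \<Rightarrow> real) \<Rightarrow> real \<Rightarrow> real" where
  "caputo \<alpha> f t =
     (let n = nat \<lceil>\<alpha>\<rceil> in
      if \<alpha> = real n then (deriv ^^ n) f t
      else 1 / Gamma (real n - \<alpha>) *
             integral {0..t} (\<lambda>s. (deriv ^^ n) f s / (t - s) powr (\<alpha> - real n + 1)))"

lemma mittag_leffler_fps_nth_0: "fps_nth (mittag_leffler_fps \<alpha>) 0 = 1"
  by (simp add: mittag_leffler_fps_def)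

lemma Gamma_ge_exp_minus_two:
  assumes "x \<ge> (1 :: real)"
  shows "Gamma x \<ge> exp (-2)"
proof (rule has_integral_le)
  show "((\<lambda>t. if t \<in> {1..2::real} then exp (-2) else 0) has_integral exp (-2 :: real)) {0..}"
    using has_integral_restrict[of "{1..2::real}" "{0..}" "\<lambda>_. exp (-2) :: real"]
      has_integral_const_real[of "exp (-2) :: real" 1 2]
    by simp
  show "((\<lambda>t. t powr (x - 1) / exp t) has_integral Gamma x) {0..}"
    using assms by (intro Gamma_integral_real) auto
  show "(if t \<in> {1..2} then exp (-2) else 0) \<le> t powr (x - 1) / exp t" for t
  proof (cases "t \<in> {1..2}")
    case True
    then have "exp (-2) * 1 \<le> exp (-t) * t powr (x - 1)"
      using assms by (intro mult_mono ge_one_powr_ge_zero) auto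
    then show ?thesis
      using True by (simp add: exp_minus field_simps)
  qed auto
qed

lemma mittag_leffler_has_fps_expansion:
  assumes "\<alpha> > 0"
  shows "mittag_leffler \<alpha> has_fps_expansion mittag_leffler_fps \<alpha>"
proof -
  have "summable (\<lambda>j. 1 / Gamma (\<alpha> * real j + 1) * (1 / 2) ^ j)"
  proof (rule summable_comparison_test')
    show "summable (\<lambda>j. exp 2 * (1 / 2 :: real) ^ j)"
      by (intro summable_mult summable_geometric) auto
    fix j :: nat
    have "Gamma (\<alpha> * real j + 1) \<ge> exp (-2)"
      using assms by (intro Gamma_ge_exp_minus_two) auto
    moreover have "exp (-2 :: real) > 0" by simp
    ultimately have pos: "0 < Gamma (\<alpha> * real j + 1)"
      by linarith
    have "1 / Gamma (\<alpha> * real j + 1) \<le> exp 2"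
      using le_imp_inverse_le[OF \<open>exp (-2) \<le> Gamma (\<alpha> * real j + 1)\<close>]
      by (simp add: exp_minus divide_inverse)
    with pos show "norm (1 / Gamma (\<alpha> * real j + 1) * (1 / 2) ^ j) \<le> exp 2 * (1 / 2) ^ j"
      by (subst norm_mult, intro mult_mono) auto
  qed
  then have "ereal (norm (1 / 2 :: real)) \<le> fps_conv_radius (mittag_leffler_fps \<alpha>)"
    unfolding fps_conv_radius_def mittag_leffler_fps_def by (intro conv_radius_geI) simp
  then have "fps_conv_radius (mittag_leffler_fps \<alpha>) > 0"
    by (rule less_le_trans[rotated]) simp
  moreover have "mittag_leffler \<alpha> = eval_fps (mittag_leffler_fps \<alpha>)"
    by (simp add: fun_eq_iff mittag_leffler_def eval_fps_def mittag_leffler_fps_def)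
  ultimately show ?thesis
    by (simp add: has_fps_expansion_def)
qed

lemma bernoulli_ml_generating:
  assumes "\<alpha> > 0" "lam > 0"
  shows "Abs_fps (\<lambda>m. bernoulli_ml \<alpha> lam m x / fact m) *
           (fps_const lam * mittag_leffler_fps \<alpha> - 1) = fps_X * fps_exp x"
proof -
  define D where "D = fps_const lam * mittag_leffler_fps \<alpha> - 1"
  have "Gamma (\<alpha> + 1) \<noteq> 0"
    using Gamma_real_pos[of "\<alpha> + 1"] assms by linarith
  then have D1: "fps_nth D 1 \<noteq> 0"
    using assms by (simp add: D_def mittag_leffler_fps_def)
  then have "D \<noteq> 0" by auto
  moreover have "subdegree D \<le> 1"
    using D1 by (rule subdegree_leI)
  ultimately have "D dvd fps_X"
    by (simp add: fps_dvd_iff)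
  then have "fps_X / D * D = fps_X"
    by simp
  moreover have "Abs_fps (\<lambda>m. bernoulli_ml \<alpha> lam m x / fact m) = fps_X / D * fps_exp x"
    by (simp add: bernoulli_ml_def D_def fps_eq_iff)
  ultimately show ?thesis
    unfolding D_def[symmetric] by (simp add: mult.assoc mult.left_commute mult.commute)
qed

lemma euler_ml_generating:
  assumes "lam > 0"
  shows "Abs_fps (\<lambda>m. euler_ml \<alpha> lam m x / fact m) *
           (fps_const lam * mittag_leffler_fps \<alpha> + 1) = 2 * fps_exp x"
proof -
  define D where "D = fps_const lam * mittag_leffler_fps \<alpha> + 1"
  have "fps_nth D 0 \<noteq> 0"
    using assms by (simp add: D_def mittag_leffler_fps_nth_0)
  then have "2 / D * D = 2"
    by (intro dvd_div_mult_self fps_unit_dvd)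
  moreover have "Abs_fps (\<lambda>m. euler_ml \<alpha> lam m x / fact m) = 2 / D * fps_exp x"
    by (simp add: euler_ml_def D_def fps_eq_iff)
  ultimately show ?thesis
    unfolding D_def[symmetric] by (metis mult.assoc mult.commute)
qed

lemma genocchi_ml_generating:
  assumes "lam > 0"
  shows "Abs_fps (\<lambda>m. genocchi_ml \<alpha> lam m x / fact m) *
           (fps_const lam * mittag_leffler_fps \<alpha> + 1) = 2 * fps_X * fps_exp x"
proof -
  define D where "D = fps_const lam * mittag_leffler_fps \<alpha> + 1"
  have "fps_nth D 0 \<noteq> 0"
    using assms by (simp add: D_def mittag_leffler_fps_nth_0)
  then have "2 * fps_X / D * D = 2 * fps_X"
    by (intro dvd_div_mult_self fps_unit_dvd)
  moreover have "Abs_fps (\<lambda>m. genocchi_ml \<alpha> lam m x / fact m) = 2 * fps_X / D * fps_exp x"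
    by (simp add: genocchi_ml_def D_def fps_eq_iff)
  ultimately show ?thesis
    unfolding D_def[symmetric] by (metis mult.assoc mult.commute)
qed

end

theory Submission
  imports Defs
begin

text \<open>
  All three families are Appell sequences: their generating function is \<open>A(z) exp (x z)\<close> with \<open>A\<close>
  independent of \<open>x\<close>. Differentiation in \<open>x\<close> multiplies such a series by \<open>z\<close>, so that
  \<open>P\<^sub>m' = m P\<^sub>m\<^sub>-\<^sub>1\<close> (\<open>DERIV_appell_poly\<close>) and the \<open>n\<close>-th derivative of \<open>P\<^sub>m\<close> is \<open>m! / (m - n)!\<close> times
  \<open>P\<^sub>m\<^sub>-\<^sub>n\<close>. The Mittag-Leffler function therefore matters only through the numbers \<open>P\<^sub>j(0)\<close>, which are
  the coefficients of \<open>P\<^sub>m\<^sub>-\<^sub>n\<close> up to binomial factors (\<open>appell_poly_binomial\<close>).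

  It remains to integrate the monomials \<open>s\<^sup>k\<close> against the kernel \<open>(t - s) powr (n - \<alpha> - 1)\<close>. This is
  a Beta integral after the substitution \<open>s = t u\<close>; its value is
  \<open>k! \<Gamma>(n - \<alpha>) / \<Gamma>(n + k - \<alpha> + 1)\<close> times \<open>t powr (n + k - \<alpha>)\<close>, and the prefactor of the Caputo
  derivative cancels \<open>\<Gamma>(n - \<alpha>)\<close>. At integer order \<open>\<alpha> = n\<close> there is no integral, but the same
  expression reduces to \<open>t\<^sup>k\<close>, so both cases obey one formula (\<open>caputo_if_deriv_eq_poly\<close>).
\<close>

text \<open>
  The Appell polynomials attached to an arbitrary series \<open>A\<close>. With the division already carried out
  inside \<open>A\<close>, the Bernoulli case with \<open>lam = 1\<close>, whose denominator vanishes at \<open>0\<close>, needs no separate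
  treatment.
\<close>

definition appell_poly :: "real fps \<Rightarrow> nat \<Rightarrow> real \<Rightarrow> real" where
  "appell_poly A m x = fact m * fps_nth (A * fps_exp x) m"

lemma appell_poly_0: "appell_poly A m 0 = fact m * fps_nth A m"
  by (simp add: appell_poly_def)

lemma appell_poly_binomial:
  "appell_poly A m x = (\<Sum>k=0..m. real (m choose k) * appell_poly A (m - k) 0 * x ^ k)"
proof -
  have "appell_poly A m x = (\<Sum>k=0..m. fact m * (x ^ k / fact k * fps_nth A (m - k)))"
    by (simp add: appell_poly_def mult.commute[of A] fps_mult_nth sum_distrib_left)
  also have "\<dots> = (\<Sum>k=0..m. real (m choose k) * appell_poly A (m - k) 0 * x ^ k)"
    by (intro sum.cong) (simp_all add: appell_poly_0 binomial_fact field_simps)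
  finally show ?thesis .
qed

text \<open>
  The Appell property: \<open>d/dx\<close> turns \<open>A(z) exp (x z)\<close> into \<open>z A(z) exp (x z)\<close>, which shifts the
  coefficients by one; the factorial weights then leave the factor \<open>m + 1\<close>. Here it is verified on
  the coefficients, each of which is a finite convolution.
\<close>

lemma DERIV_appell_poly:
  "(appell_poly A (Suc m) has_field_derivative real (Suc m) * appell_poly A m x) (at x)"
proof -
  \<comment> \<open>Isolating the constant term of the convolution makes every remaining exponent a successor.\<close>
  have eq: "appell_poly A (Suc m) =
      (\<lambda>x. fact (Suc m) * ((\<Sum>i=0..m. fps_nth A i * (x ^ Suc (m - i) / fact (Suc (m - i))))
                           + fps_nth A (Suc m)))"
    by (simp add: fun_eq_iff appell_poly_def fps_mult_nth Suc_diff_le del: fact_Suc power_Suc)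
  have deriv_term: "((\<lambda>x. fps_nth A i * (x ^ Suc j / fact (Suc j))) has_field_derivative
                fps_nth A i * (x ^ j / fact j)) (at x)" for i j
  proof -
    have "((\<lambda>x. x ^ Suc j) has_field_derivative real (Suc j) * x ^ j) (at x)"
      using DERIV_pow[of "Suc j" x] by simp
    then have "((\<lambda>x. fps_nth A i * (x ^ Suc j / fact (Suc j))) has_field_derivative
        fps_nth A i * (real (Suc j) * x ^ j / fact (Suc j))) (at x)"
      by (intro DERIV_cmult DERIV_cdivide)
    then show ?thesis
      by (simp del: of_nat_Suc power_Suc)
  qed
  have "(appell_poly A (Suc m) has_field_derivative
          fact (Suc m) * ((\<Sum>i=0..m. fps_nth A i * (x ^ (m - i) / fact (m - i))) + 0)) (at x)"
    unfolding eq by (intro DERIV_cmult DERIV_add DERIV_sum deriv_term DERIV_const)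
  then show ?thesis
    by (simp add: appell_poly_def fps_mult_nth algebra_simps)
qed

lemma iterated_deriv_appell_poly:
  assumes "n \<le> m"
  shows "(deriv ^^ n) (appell_poly A m) = (\<lambda>x. fact m / fact (m - n) * appell_poly A (m - n) x)"
  using assms
proof (induction n)
  case (Suc n)
  define p where "p = m - Suc n"
  have p: "m - n = Suc p"
    using Suc.prems by (simp add: p_def)
  have "deriv (\<lambda>x. fact m / fact (Suc p) * appell_poly A (Suc p) x) =
        (\<lambda>x. fact m / fact (Suc p) * (real (Suc p) * appell_poly A p x))"
    by (intro ext DERIV_imp_deriv DERIV_cmult DERIV_appell_poly)
  also have "\<dots> = (\<lambda>x. fact m / fact p * appell_poly A p x)"
    by (simp add: fun_eq_iff del: of_nat_Suc)
  finally show ?case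
    using Suc.IH Suc.prems by (simp add: p p_def[symmetric] del: fact_Suc of_nat_Suc)
qed simp

lemma Gamma_real_plus_1: "Gamma (real k + 1) = fact k"
  using Gamma_fact[of k, where 'a = real] by (simp add: add.commute)

text \<open>
  The Beta integral rescaled to \<open>{0..t}\<close>. The kernel appears as a quotient because that is its form
  in the Caputo derivative.
\<close>

lemma has_integral_power_over_kernel:
  fixes b t :: real
  assumes b: "b > 0" and t: "t > 0"
  shows "((\<lambda>s. s ^ k / (t - s) powr (1 - b)) has_integral
           fact k * Gamma b / Gamma (real k + b + 1) * t powr (real k + b)) {0..t}"
proof -
  define C where "C = t powr (real k + b - 1)"
  have "((\<lambda>u. u powr (real k + 1 - 1) * (1 - u) powr (b - 1)) has_integral
           Beta (real k + 1) b) {0..1}"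
    using b by (intro has_integral_Beta_real) auto
  then have "((\<lambda>u. C * (u powr (real k + 1 - 1) * (1 - u) powr (b - 1))) has_integral
           C * Beta (real k + 1) b) {0..1}"
    by (rule has_integral_mult_right)
  from has_integral_stretch_real[OF this, of "1 / t"] t
  have "((\<lambda>s. C * ((s / t) powr real k * (1 - s / t) powr (b - 1))) has_integral
           t * (C * Beta (real k + 1) b)) ((\<lambda>x. x * t) ` {0..1})"
    by simp
  also have "(\<lambda>x. x * t) ` {0..1} = {0..t}"
    using t image_mult_atLeastAtMost[of t 0 1] by (simp add: mult.commute[of _ t])
  also have "t * (C * Beta (real k + 1) b) =
      fact k * Gamma b / Gamma (real k + b + 1) * t powr (real k + b)"
  proof -
    have "t * C = t powr (real k + b)"
      using t by (simp add: C_def powr_mult_base)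
    then show ?thesis
      unfolding Beta_def Gamma_real_plus_1 by (simp add: ac_simps)
  qed
  finally have integral: "((\<lambda>s. C * ((s / t) powr real k * (1 - s / t) powr (b - 1))) has_integral
      fact k * Gamma b / Gamma (real k + b + 1) * t powr (real k + b)) {0..t}" .
  have integrand: "s ^ k / (t - s) powr (1 - b) = C * ((s / t) powr real k * (1 - s / t) powr (b - 1))"
    if "s \<in> {0..t} - {0, t}" for s
  proof -
    have s: "0 < s" "s < t"
      using that by auto
    have "1 - s / t = (t - s) / t"
      using t by (simp add: field_simps)
    then have "C * ((s / t) powr real k * (1 - s / t) powr (b - 1)) =
        (C / (t powr real k * t powr (b - 1))) * (s powr real k * (t - s) powr (b - 1))"
      using s t by (simp add: powr_divide)
    also have "t powr real k * t powr (b - 1) = C"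
      by (simp add: C_def add_diff_eq flip: powr_add)
    also have "(t - s) powr (b - 1) = 1 / (t - s) powr (1 - b)"
      using powr_minus_divide[of "t - s" "1 - b"] by simp
    finally show ?thesis
      using s t by (simp add: C_def powr_realpow)
  qed
  \<comment> \<open>The two integrands differ at \<open>s = 0\<close> for \<open>k = 0\<close>, since \<open>0 ^ 0 = 1\<close> but \<open>0 powr 0 = 0\<close>.\<close>
  show ?thesis
    by (rule has_integral_spike_finite[where S = "{0, t}", OF _ integrand integral]) simp_all
qed

text \<open>
  By linearity it suffices to know the fractional integral of each monomial of the \<open>n\<close>-th derivative.
  For \<open>\<alpha> = n\<close> the coefficient \<open>k! / \<Gamma>(k + 1)\<close> is \<open>1\<close> and the right-hand side is the derivative itself.
  For \<open>\<alpha> < n\<close> the kernel exponent \<open>n - \<alpha> - 1\<close> exceeds \<open>-1\<close>, so the singularity at \<open>s = t\<close> is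
  integrable.
\<close>

lemma caputo_if_deriv_eq_poly:
  assumes \<alpha>: "\<alpha> > 0" and n: "n = nat \<lceil>\<alpha>\<rceil>" and t: "t > 0"
    and f: "(deriv ^^ n) f = (\<lambda>s. \<Sum>k\<in>K. c k * s ^ k)" and K: "finite K"
  shows "caputo \<alpha> f t =
    (\<Sum>k\<in>K. c k * (fact k / Gamma (real n + real k - \<alpha> + 1) * t powr (real k - \<alpha> + real n)))"
proof (cases "\<alpha> = real n")
  case True
  have "caputo \<alpha> f t = (\<Sum>k\<in>K. c k * t ^ k)"
    using n True f by (simp add: caputo_def Let_def)
  then show ?thesis
    using True t by (simp add: powr_realpow Gamma_real_plus_1)
next
  case False
  define b where "b = real n - \<alpha>"
  have b: "b > 0"
    using False n \<alpha> by (simp add: b_def) linarith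
  then have "Gamma b > 0"
    by (rule Gamma_real_pos)
  have "((\<lambda>s. \<Sum>k\<in>K. c k * (s ^ k / (t - s) powr (1 - b))) has_integral
      (\<Sum>k\<in>K. c k * (fact k * Gamma b / Gamma (real k + b + 1) * t powr (real k + b)))) {0..t}"
    by (intro has_integral_sum has_integral_mult_right has_integral_power_over_kernel K b t)
  then have "integral {0..t} (\<lambda>s. (deriv ^^ n) f s / (t - s) powr (\<alpha> - real n + 1)) =
      (\<Sum>k\<in>K. c k * (fact k * Gamma b / Gamma (real k + b + 1) * t powr (real k + b)))"
    by (intro integral_unique) (simp add: f b_def sum_divide_distrib algebra_simps)
  then have "caputo \<alpha> f t = 1 / Gamma b *
      (\<Sum>k\<in>K. c k * (fact k * Gamma b / Gamma (real k + b + 1) * t powr (real k + b)))"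
    using False n by (simp add: caputo_def Let_def b_def)
  also have "\<dots> = (\<Sum>k\<in>K. c k * (fact k / Gamma (real k + b + 1) * t powr (real k + b)))"
    using \<open>Gamma b > 0\<close> by (simp add: sum_distrib_left)
  finally show ?thesis
    by (simp add: b_def algebra_simps)
qed

lemma caputo_appell_poly:
  assumes "\<alpha> > 0" and "n = nat \<lceil>\<alpha>\<rceil>" and "m \<ge> n" and "t > 0"
  shows "caputo \<alpha> (appell_poly A m) t =
    Gamma (real m + 1) / Gamma (real m - real n + 1) *
    (\<Sum>k=0..m - n. fact k * real ((m - n) choose k) * appell_poly A (m - n - k) 0
       / Gamma (real n + real k - \<alpha> + 1) * t powr (real k - \<alpha> + real n))"
proof -
  define r :: real where "r = fact m / fact (m - n)"
  define c where "c = (\<lambda>k. r * (real ((m - n) choose k) * appell_poly A (m - n - k) 0))"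
  have "(deriv ^^ n) (appell_poly A m) = (\<lambda>s. \<Sum>k\<in>{0..m - n}. c k * s ^ k)"
  proof
    fix s
    have "(deriv ^^ n) (appell_poly A m) s = r * appell_poly A (m - n) s"
      by (simp only: iterated_deriv_appell_poly[OF \<open>m \<ge> n\<close>] r_def)
    also have "\<dots> = (\<Sum>k\<in>{0..m - n}. c k * s ^ k)"
      by (subst appell_poly_binomial) (simp only: c_def sum_distrib_left mult.assoc)
    finally show "(deriv ^^ n) (appell_poly A m) s = (\<Sum>k\<in>{0..m - n}. c k * s ^ k)" .
  qed
  then have "caputo \<alpha> (appell_poly A m) t = (\<Sum>k\<in>{0..m - n}. c k *
      (fact k / Gamma (real n + real k - \<alpha> + 1) * t powr (real k - \<alpha> + real n)))"
    by (intro caputo_if_deriv_eq_poly assms finite_atLeastAtMost)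
  also have "\<dots> = r *
    (\<Sum>k=0..m - n. fact k * real ((m - n) choose k) * appell_poly A (m - n - k) 0
       / Gamma (real n + real k - \<alpha> + 1) * t powr (real k - \<alpha> + real n))"
    unfolding sum_distrib_left c_def
    by (intro sum.cong refl) (simp only: mult_ac times_divide_eq_left times_divide_eq_right)
  finally show ?thesis
    by (simp only: r_def Gamma_real_plus_1 of_nat_diff[OF \<open>m \<ge> n\<close>, symmetric])
qed

theorem theorem6:
  fixes \<alpha> lam t :: real and n m :: nat
  assumes "\<alpha> > 0" and "lam > 0"
    and "n = nat \<lceil>\<alpha>\<rceil>"
    and "m \<ge> n"
    and "t > 0"
  shows "caputo \<alpha> (bernoulli_ml \<alpha> lam m) t =
           Gamma (real m + 1) / Gamma (real m - real n + 1) *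
           (\<Sum>k=0..m - n. fact k * real ((m - n) choose k) * bernoulli_ml_num \<alpha> lam (m - n - k)
              / Gamma (real n + real k - \<alpha> + 1) * t powr (real k - \<alpha> + real n)) \<and>
         caputo \<alpha> (euler_ml \<alpha> lam m) t =
           Gamma (real m + 1) / Gamma (real m - real n + 1) *
           (\<Sum>k=0..m - n. fact k * real ((m - n) choose k) * euler_ml_num \<alpha> lam (m - n - k)
              / Gamma (real n + real k - \<alpha> + 1) * t powr (real k - \<alpha> + real n)) \<and>
         caputo \<alpha> (genocchi_ml \<alpha> lam m) t =
           Gamma (real m + 1) / Gamma (real m - real n + 1) *
           (\<Sum>k=0..m - n. fact k * real ((m - n) choose k) * genocchi_ml_num \<alpha> lam (m - n - k)
              / Gamma (real n + real k - \<alpha> + 1) * t powr (real k - \<alpha> + real n))"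
proof -
  define B where "B = fps_X / (fps_const lam * mittag_leffler_fps \<alpha> - 1)"
  define E where "E = 2 / (fps_const lam * mittag_leffler_fps \<alpha> + 1)"
  define G where "G = 2 * fps_X / (fps_const lam * mittag_leffler_fps \<alpha> + 1)"
  have B: "bernoulli_ml \<alpha> lam = appell_poly B"
    by (intro ext) (simp only: bernoulli_ml_def appell_poly_def B_def)
  have E: "euler_ml \<alpha> lam = appell_poly E"
    by (intro ext) (simp only: euler_ml_def appell_poly_def E_def)
  have G: "genocchi_ml \<alpha> lam = appell_poly G"
    by (intro ext) (simp only: genocchi_ml_def appell_poly_def G_def)
  show ?thesis
    unfolding bernoulli_ml_num_def euler_ml_num_def genocchi_ml_num_def B E G
    by (intro conjI caputo_appell_poly assms)
qed

end
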